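(* Let $L(\lambda)=\lambda M+K\in\mathbb{R}^{n\times n}[\lambda]$ with $M^T=-M$ and $K=K^T$ positive definite. Let $(\lambda_i^c,x_i^c),(\overline{\lambda_i^c},\overline{x_i^c})$, $1\le i\le p$, be eigenpairs of $L(\lambda)$ with $\lambda_i^c\neq0$ (hence $\lambda_i^c$ is purely imaginary), the eigenvectors being normalized such that $\hat X_c^TK\hat X_c=I_{2p}$, where $$\hat X_c=[\mathrm{re}(x_1^c)\ \mathrm{im}(x_1^c)\ \cdots\ \mathrm{re}(x_p^c)\ \mathrm{im}(x_p^c)].$$ Let $\lambda_1^a,\dots,\lambda_p^a$ be purely imaginary numbers, and let $\Lambda_c=\mathrm{diag}(\Lambda_1^c,\dots,\Lambda_p^c)$, $\Lambda_a=\mathrm{diag}(\Lambda_1^a,\dots,\Lambda_p^a)$ with $$\Lambda_j^c=\begin{bmatrix}0&\mathrm{im}(\lambda_j^c)\\-\mathrm{im}(\lambda_j^c)&0\end{bmatrix},\qquad \Lambda_j^a=\begin{bmatrix}0&\mathrm{im}(\lambda_j^a)\\-\mathrm{im}(\lambda_j^a)&0\end{bmatrix}.$$ Let $(X_f,\Lambda_f)$ be a deflating pair of $L(\lambda)$ complementary to $(\hat X_c,\Lambda_c)$ such that $\sigma(\Lambda_c)\cap\sigma(-\Lambda_f^T)=\emptyset$. For arbitrary $\alpha_j,\beta_j\in\mathbb{R}$ $(1\le j\le p)$ let $Z_k=\mathrm{diag}(Z_1^{(k)},\dots,Z_p^{(k)})$, $k=1,2$, with $Z_j^{(1)}=\begin{bmatrix}0&\alpha_j\\-\alpha_j&0\end{bmatrix}$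 and $Z_j^{(2)}=\beta_jI_2$. Put $H_a=(I_{2p}-\Lambda_a^2)^{-1}$ and $$\hat M=H_a\left[\Lambda_c^{-1}(\Lambda_c-\Lambda_a)\Lambda_a+Z_1+Z_2\Lambda_a\right],\qquad \hat K=H_a\left[\Lambda_c^{-1}(\Lambda_a-\Lambda_c)-Z_1\Lambda_a-Z_2\Lambda_a^2\right],$$ $$\Delta M=K\hat X_c\hat M\hat X_c^TK,\qquad \Delta K=K\hat X_c\hat K\hat X_c^TK.$$ Then $(\hat X_c,\Lambda_a)$ and $(X_f,\Lambda_f)$ are complementary deflating pairs of $L_\Delta(\lambda)=\lambda(M+\Delta M)+(K+\Delta K)$, and $L_\Delta(\lambda)$ is a real $T$-even pencil. Moreover $K+\Delta K$ is positive definite if $Z_1,Z_2$ are chosen such that $\Lambda_c^{-1}(\Lambda_a-\Lambda_c)-Z_1\Lambda_a-Z_2\Lambda_a^2$ is a diagonal matrix with non-negative diagonal entries.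
   Context: A pencil $\lambda M+K$ is $T$-even if $M^T=-M$ and $K^T=K$. A deflating pair of a pencil $\lambda M+K\in\mathbb{C}^{n\times n}[\lambda]$ is a matrix pair $(X,\Lambda)\in\mathbb{C}^{n\times p}\times\mathbb{C}^{p\times p}$ with $\operatorname{rank}X=p\le n$ and $MX\Lambda+KX=0$ ($\Lambda$ need not be diagonal). Two deflating pairs $(X_1,\Lambda_1)$, $(X_2,\Lambda_2)$ are complementary if $[X_1\ X_2]$ is a nonsingular square matrix. $\sigma(\Lambda)$ is the spectrum of $\Lambda$; $\mathrm{re}$ and $\mathrm{im}$ denote (entrywise) real and imaginary parts. *)

theory Defs
  imports
    "Jordan_Normal_Form.Matrix"
    "Jordan_Normal_Form.Gauss_Jordan_Elimination"
    "Jordan_Normal_Form.DL_Rank"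
    "Jordan_Normal_Form.Spectral_Radius"
begin

text \<open>A pencil \<open>\<lambda> M + K\<close> is represented by its coefficients \<open>M\<close> and \<open>K\<close>. Eigenpairs and
  deflating pairs are complex, also when the pencil is real; \<open>cmat\<close> is the embedding of real
  matrices into complex ones.\<close>

abbreviation cmat :: "real mat \<Rightarrow> complex mat" where
  "cmat \<equiv> map_mat complex_of_real"

definition pencil :: "'a :: comm_ring_1 mat \<Rightarrow> 'a mat \<Rightarrow> 'a \<Rightarrow> 'a mat" where
  "pencil M K z = z \<cdot>\<^sub>m M + K"

definition eigenpair :: "nat \<Rightarrow> complex mat \<Rightarrow> complex mat \<Rightarrow> complex \<Rightarrow> complex vec \<Rightarrow> bool" where
  "eigenpair n M K z x \<longleftrightarrow>
     x \<in> carrier_vec n \<and> x \<noteq> 0\<^sub>v n \<and> pencil M K z *\<^sub>v x = 0\<^sub>v n"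

definition T_even :: "'a :: comm_ring_1 mat \<Rightarrow> 'a mat \<Rightarrow> bool" where
  "T_even M K \<longleftrightarrow> transpose_mat M = - M \<and> transpose_mat K = K"

definition pos_def :: "nat \<Rightarrow> real mat \<Rightarrow> bool" where
  "pos_def n K \<longleftrightarrow> K \<in> carrier_mat n n \<and> transpose_mat K = K \<and>
     (\<forall>v \<in> carrier_vec n. v \<noteq> 0\<^sub>v n \<longrightarrow> v \<bullet> (K *\<^sub>v v) > 0)"

definition deflating_pair ::
  "nat \<Rightarrow> nat \<Rightarrow> complex mat \<Rightarrow> complex mat \<Rightarrow> complex mat \<times> complex mat \<Rightarrow> bool" where
  "deflating_pair n p M K P \<longleftrightarrow> (case P of (X, \<Lambda>) \<Rightarrow>
     X \<in> carrier_mat n p \<and> \<Lambda> \<in> carrier_mat p p \<and>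
     vec_space.rank n X = p \<and> p \<le> n \<and>
     M * X * \<Lambda> + K * X = 0\<^sub>m n p)"

definition complementary ::
  "nat \<Rightarrow> complex mat \<times> complex mat \<Rightarrow> complex mat \<times> complex mat \<Rightarrow> bool" where
  "complementary n P\<^sub>1 P\<^sub>2 \<longleftrightarrow>
     invertible_mat (mat_of_cols n (cols (fst P\<^sub>1) @ cols (fst P\<^sub>2)))"

text \<open>Used for invertible matrices only; otherwise the value is unspecified.\<close>

definition mat_inv :: "'a :: field mat \<Rightarrow> 'a mat" where
  "mat_inv A = the (mat_inverse A)"

definition re_im_mat :: "nat \<Rightarrow> nat \<Rightarrow> (nat \<Rightarrow> complex vec) \<Rightarrow> real mat" where
  "re_im_mat n p x =
     mat_of_cols n (concat (map (\<lambda>j. [map_vec Re (x j), map_vec Im (x j)]) [0..<p]))"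

definition skew_blocks :: "nat \<Rightarrow> (nat \<Rightarrow> real) \<Rightarrow> real mat" where
  "skew_blocks p w =
     diag_block_mat (map (\<lambda>j. mat_of_rows_list 2 [[0, w j], [- w j, 0]]) [0..<p])"

definition scalar_blocks :: "nat \<Rightarrow> (nat \<Rightarrow> real) \<Rightarrow> real mat" where
  "scalar_blocks p b = diag_block_mat (map (\<lambda>j. b j \<cdot>\<^sub>m 1\<^sub>m 2) [0..<p])"

end

theory Submission
  imports Defs
begin

text \<open>The real matrix with rows \<open>(b, w)\<close> and \<open>(-w, b)\<close> represents the complex number
  \<open>b + \<i> w\<close>, and transposition becomes conjugation. So all the block matrices \<open>\<Lambda>c\<close>, \<open>\<Lambda>a\<close>, \<open>Z1\<close>,
  \<open>Z2\<close>, \<open>Ha\<close>, \<open>Mhat\<close>, \<open>Khat\<close> are images of sequences of \<open>p\<close> complex numbers under an embedding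
  \<open>complex_blocks p\<close> that respects sums, products, inverses and transposes. They commute, and every
  identity between them is checked on scalars. With \<open>c = \<i> Im(lamc)\<close>, \<open>a = \<i> Im(lama)\<close> purely
  imaginary, \<open>1 - a^2\<close> is positive, \<open>Khat\<close> comes from real and \<open>Mhat\<close> from imaginary numbers;
  hence \<open>\<Delta>K\<close> is symmetric and \<open>\<Delta>M\<close> is skew.

  The eigenpairs say \<open>M Xc \<Lambda>c = - K Xc\<close>, once the eigenvalues are known to be imaginary and nonzero
  (\<open>eigenvalue_imaginary\<close>, \<open>re_im_mat_deflating\<close>). So
  \<open>M Xc = - K Xc \<Lambda>c^{-1}\<close>, while the normalization \<open>Xc^T K Xc = I\<close> gives \<open>\<Delta>M Xc = K Xc Mhat\<close> and
  \<open>\<Delta>K Xc = K Xc Khat\<close>. The residual of \<open>(Xc, \<Lambda>a)\<close> in the modified pencil is therefore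
  \<open>K Xc\<close> times \<open>(Mhat - \<Lambda>c^{-1}) \<Lambda>a + I + Khat\<close>. The parameters \<open>Z1\<close> and \<open>Z2\<close> cancel in
  \<open>Mhat \<Lambda>a + Khat\<close>, the remaining factor \<open>I - \<Lambda>a^2\<close> cancels \<open>Ha\<close>, and what is left vanishes.

  The pair \<open>(Xf, \<Lambda>f)\<close> is untouched because \<open>Xc^T K Xf = 0\<close>, which makes \<open>\<Delta>M\<close> and \<open>\<Delta>K\<close> annihilate
  \<open>Xf\<close>: the matrix \<open>Y = Xc^T M Xf\<close> satisfies the Sylvester equation \<open>Y \<Lambda>f = \<Lambda>c Y\<close>, and the
  disjointness of the spectra forces \<open>Y = 0\<close> (\<open>complex_blocks_sylvester\<close>,
  \<open>K_orthogonal_of_disjoint_spectra\<close>). Finally \<open>v^T \<Delta>K v = y^T Khat y\<close> with \<open>y = Xc^T K v\<close>, which is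
  nonnegative when the numbers behind \<open>Khat\<close> are.\<close>

section \<open>Block diagonal matrices as complex numbers\<close>

text \<open>Given entrywise, not as a block diagonal matrix, so that identities can be checked entry by
  entry; \<open>skew_blocks_eq\<close> and \<open>scalar_blocks_eq\<close> make the connection.\<close>

definition complex_blocks :: "nat \<Rightarrow> (nat \<Rightarrow> complex) \<Rightarrow> real mat" where
  "complex_blocks p z = mat (2 * p) (2 * p) (\<lambda>(i, j).
     if i div 2 \<noteq> j div 2 then 0
     else if i = j then Re (z (i div 2))
     else if even i then Im (z (i div 2)) else - Im (z (i div 2)))"

lemma complex_blocks_carrier [simp]: "complex_blocks p z \<in> carrier_mat (2 * p) (2 * p)"
  by (simp add: complex_blocks_def)

lemma complex_blocks_dim [simp]:
  "dim_row (complex_blocks p z) = 2 * p" "dim_col (complex_blocks p z) = 2 * p"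
  by (simp_all add: complex_blocks_def)

lemma complex_blocks_cong:
  assumes "\<And>j. j < p \<Longrightarrow> z j = w j"
  shows "complex_blocks p z = complex_blocks p w"
proof (rule eq_matI; simp)
  fix i j assume "i < 2 * p" "j < 2 * p"
  then show "complex_blocks p z $$ (i, j) = complex_blocks p w $$ (i, j)"
    using assms[of "i div 2"] by (auto simp: complex_blocks_def)
qed

lemma complex_blocks_index:
  assumes "j < p" "k < p"
  shows "complex_blocks p z $$ (2 * j, 2 * k) = (if j = k then Re (z j) else 0)"
    and "complex_blocks p z $$ (2 * j, Suc (2 * k)) = (if j = k then Im (z j) else 0)"
    and "complex_blocks p z $$ (Suc (2 * j), 2 * k) = (if j = k then - Im (z j) else 0)"
    and "complex_blocks p z $$ (Suc (2 * j), Suc (2 * k)) = (if j = k then Re (z j) else 0)"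
  using assms by (auto simp: complex_blocks_def)

lemma dim_diag_block_two [simp]:
  assumes "\<And>j. f j \<in> carrier_mat 2 2"
  shows "dim_row (diag_block_mat (map f [0..<p])) = 2 * p"
    and "dim_col (diag_block_mat (map f [0..<p])) = 2 * p"
  using assms by (simp_all add: dim_diag_block_mat o_def carrier_matD[OF assms] sum_list_triv)

lemma diag_block_two_index:
  assumes f: "\<And>j. f j \<in> carrier_mat 2 2" and "i < 2 * p" "k < 2 * p"
  shows "diag_block_mat (map f [0..<p]) $$ (i, k) =
    (if i div 2 = k div 2 then f (i div 2) $$ (i mod 2, k mod 2) else 0)"
  using assms(2,3)
proof (induction p)
  case 0
  then show ?case by simp
next
  case (Suc p)
  have d [simp]: "dim_row (f j) = 2" "dim_col (f j) = 2" for j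
    using f[of j] by auto
  have dd: "dim_row (diag_block_mat (map f [0..<p])) = 2 * p"
    "dim_col (diag_block_mat (map f [0..<p])) = 2 * p"
    using dim_diag_block_two[OF f] by auto
  have *: "j div 2 = p \<and> j mod 2 = j - 2 * p" if "\<not> j < 2 * p" "j < 2 * Suc p" for j
    using that by presburger
  have **: "j div 2 < p" if "j < 2 * p" for j
    using that by presburger
  show ?case
  proof (cases "i < 2 * p \<or> k < 2 * p")
    case True
    then show ?thesis
      using Suc.prems *[of i] *[of k] **[of i] **[of k] Suc.IH
      by (cases "i < 2 * p"; cases "k < 2 * p") (auto simp: diag_block_mat_append dd Let_def)
  next
    case False
    then have "i - 2 * p < 2" "k - 2 * p < 2" using Suc.prems by auto
    with False show ?thesis
      using Suc.prems *[of i] *[of k]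
      by (simp add: diag_block_mat_append dd Let_def)
  qed
qed

lemma skew_blocks_eq: "skew_blocks p w = complex_blocks p (\<lambda>j. \<i> * of_real (w j))"
proof -
  have f: "mat_of_rows_list 2 [[0, w j], [- w j, 0]] \<in> carrier_mat 2 2" for j
    by (rule carrier_matI) (simp_all add: mat_of_rows_list_def)
  show ?thesis
  proof (rule eq_matI)
    fix i k assume "i < dim_row (complex_blocks p (\<lambda>j. \<i> * of_real (w j)))"
      "k < dim_col (complex_blocks p (\<lambda>j. \<i> * of_real (w j)))"
    then have ik: "i < 2 * p" "k < 2 * p" by auto
    have "i mod 2 = 0 \<or> i mod 2 = 1" "k mod 2 = 0 \<or> k mod 2 = 1" by auto
    moreover have "i = k \<longleftrightarrow> i div 2 = k div 2 \<and> i mod 2 = k mod 2"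
      by (metis div_mult_mod_eq)
    ultimately show "skew_blocks p w $$ (i, k) = complex_blocks p (\<lambda>j. \<i> * of_real (w j)) $$ (i, k)"
      unfolding skew_blocks_def diag_block_two_index[OF f ik]
      using ik by (auto simp: complex_blocks_def mat_of_rows_list_def even_iff_mod_2_eq_zero)
  qed (use dim_diag_block_two[OF f] in \<open>simp_all add: skew_blocks_def\<close>)
qed

lemma scalar_blocks_eq: "scalar_blocks p b = complex_blocks p (\<lambda>j. of_real (b j))"
proof -
  have f: "b j \<cdot>\<^sub>m 1\<^sub>m 2 \<in> carrier_mat 2 2" for j by simp
  show ?thesis
  proof (rule eq_matI)
    fix i k assume "i < dim_row (complex_blocks p (\<lambda>j. of_real (b j)))"
      "k < dim_col (complex_blocks p (\<lambda>j. of_real (b j)))"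
    then have ik: "i < 2 * p" "k < 2 * p" by auto
    have "i = k \<longleftrightarrow> i div 2 = k div 2 \<and> i mod 2 = k mod 2"
      by (metis div_mult_mod_eq)
    then show "scalar_blocks p b $$ (i, k) = complex_blocks p (\<lambda>j. of_real (b j)) $$ (i, k)"
      unfolding scalar_blocks_def diag_block_two_index[OF f ik]
      using ik by (auto simp: complex_blocks_def)
  qed (use dim_diag_block_two[OF f] in \<open>simp_all add: scalar_blocks_def\<close>)
qed

text \<open>Multiplication from the right mixes only the two columns of each block. This single sum
  computation yields products of block matrices, the eigenvalue equation in real form and the complex
  eigenvectors below, so it is stated over any field that contains the reals.\<close>

lemma mult_complex_blocks_index:
  fixes A :: "'a :: real_field mat"
  assumes A: "A \<in> carrier_mat m (2 * p)" and "i < m" "j < p"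
  shows "(A * map_mat of_real (complex_blocks p z)) $$ (i, 2 * j) =
      A $$ (i, 2 * j) * of_real (Re (z j)) - A $$ (i, Suc (2 * j)) * of_real (Im (z j))"
    and "(A * map_mat of_real (complex_blocks p z)) $$ (i, Suc (2 * j)) =
      A $$ (i, 2 * j) * of_real (Im (z j)) + A $$ (i, Suc (2 * j)) * of_real (Re (z j))"
proof -
  have *: "(A * map_mat of_real (complex_blocks p z)) $$ (i, k) =
      A $$ (i, 2 * j) * of_real (complex_blocks p z $$ (2 * j, k)) +
      A $$ (i, Suc (2 * j)) * of_real (complex_blocks p z $$ (Suc (2 * j), k))"
    if "k div 2 = j" for k
  proof -
    from that assms have k: "k < 2 * p" by auto
    have "(A * map_mat of_real (complex_blocks p z)) $$ (i, k) =
        (\<Sum>l = 0..<2 * p. A $$ (i, l) * of_real (complex_blocks p z $$ (l, k)))"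
      using assms k by (auto simp: scalar_prod_def intro!: sum.cong)
    also have "\<dots> = (\<Sum>l \<in> {2 * j, Suc (2 * j)}. A $$ (i, l) * of_real (complex_blocks p z $$ (l, k)))"
    proof (rule sum.mono_neutral_right)
      show "\<forall>l \<in> {0..<2 * p} - {2 * j, Suc (2 * j)}.
        A $$ (i, l) * of_real (complex_blocks p z $$ (l, k)) = 0"
      proof
        fix l assume l: "l \<in> {0..<2 * p} - {2 * j, Suc (2 * j)}"
        then have "l div 2 \<noteq> j" by auto
        then show "A $$ (i, l) * of_real (complex_blocks p z $$ (l, k)) = 0"
          using l k that by (auto simp: complex_blocks_def)
      qed
    qed (use assms in auto)
    finally show ?thesis by simp
  qed
  show "(A * map_mat of_real (complex_blocks p z)) $$ (i, 2 * j) =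
      A $$ (i, 2 * j) * of_real (Re (z j)) - A $$ (i, Suc (2 * j)) * of_real (Im (z j))"
    using *[of "2 * j"] \<open>j < p\<close> by (simp add: complex_blocks_def)
  show "(A * map_mat of_real (complex_blocks p z)) $$ (i, Suc (2 * j)) =
      A $$ (i, 2 * j) * of_real (Im (z j)) + A $$ (i, Suc (2 * j)) * of_real (Re (z j))"
    using *[of "Suc (2 * j)"] \<open>j < p\<close> by (simp add: complex_blocks_def)
qed

lemma map_mat_of_real_real [simp]: "map_mat of_real (A :: real mat) = A"
  by (rule eq_matI) auto

lemma less_double_cases:
  assumes "k < 2 * (p :: nat)"
  obtains j where "j < p" "k = 2 * j" | j where "j < p" "k = Suc (2 * j)"
proof (cases "even k")
  case True
  then show thesis using assms that(1)[of "k div 2"] by auto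
next
  case False
  then show thesis using assms that(2)[of "k div 2"] by (auto simp: odd_two_times_div_two_succ)
qed

lemma complex_blocks_mult:
  "complex_blocks p z * complex_blocks p w = complex_blocks p (\<lambda>j. z j * w j)"
proof (rule eq_matI)
  fix i k assume "i < dim_row (complex_blocks p (\<lambda>j. z j * w j))"
    "k < dim_col (complex_blocks p (\<lambda>j. z j * w j))"
  then have i: "i < 2 * p" and k: "k < 2 * p" by auto
  note m = mult_complex_blocks_index[OF complex_blocks_carrier i, of _ z w, unfolded map_mat_of_real_real]
  show "(complex_blocks p z * complex_blocks p w) $$ (i, k) = complex_blocks p (\<lambda>j. z j * w j) $$ (i, k)"
    using k
  proof (cases rule: less_double_cases)
    case (1 j)
    from i show ?thesis
      by (cases rule: less_double_cases)
        (use 1 m(1)[of j] in \<open>auto simp: complex_blocks_index simp del: index_mult_mat\<close>)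
  next
    case (2 j)
    from i show ?thesis
      by (cases rule: less_double_cases)
        (use 2 m(2)[of j] in \<open>auto simp: complex_blocks_index simp del: index_mult_mat\<close>)
  qed
qed simp_all

lemma complex_blocks_add:
  "complex_blocks p z + complex_blocks p w = complex_blocks p (\<lambda>j. z j + w j)"
  by (rule eq_matI) (auto simp: complex_blocks_def)

lemma complex_blocks_minus:
  "complex_blocks p z - complex_blocks p w = complex_blocks p (\<lambda>j. z j - w j)"
  by (rule eq_matI) (auto simp: complex_blocks_def)

lemma complex_blocks_one: "1\<^sub>m (2 * p) = complex_blocks p (\<lambda>_. 1)"
  by (rule eq_matI) (auto simp: complex_blocks_def)

lemma complex_blocks_zero: "complex_blocks p (\<lambda>_. 0) = 0\<^sub>m (2 * p) (2 * p)"
  by (rule eq_matI) (auto simp: complex_blocks_def)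

lemma complex_blocks_uminus: "- complex_blocks p z = complex_blocks p (\<lambda>j. - z j)"
  by (rule eq_matI) (auto simp: complex_blocks_def)

lemma complex_blocks_square: "complex_blocks p z ^\<^sub>m 2 = complex_blocks p (\<lambda>j. z j * z j)"
  by (simp add: numeral_2_eq_2 complex_blocks_mult)

lemma complex_blocks_transpose:
  "transpose_mat (complex_blocks p z) = complex_blocks p (\<lambda>j. cnj (z j))"
  by (rule eq_matI) (auto simp: complex_blocks_def, presburger+)

lemma mat_inv_eqI:
  assumes A: "A \<in> carrier_mat n n" and B: "B \<in> carrier_mat n n" and AB: "A * B = 1\<^sub>m n"
    and BA: "B * A = 1\<^sub>m n"
  shows "mat_inv A = B"
proof (cases "mat_inverse A")
  case None
  have "A \<in> Units (ring_mat TYPE('a) n n)"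
    unfolding Units_def ring_mat_def using assms by auto
  with mat_inverse(1)[OF A None, of n] show ?thesis by blast
next
  case (Some C)
  from mat_inverse(2)[OF A Some] have C: "C * A = 1\<^sub>m n" "C \<in> carrier_mat n n" by auto
  have "C = C * (A * B)" using C AB by simp
  also have "\<dots> = (C * A) * B" by (rule assoc_mult_mat[OF C(2) A B, symmetric])
  finally show ?thesis using B C Some by (simp add: mat_inv_def)
qed

lemma complex_blocks_inverse:
  assumes "\<And>j. j < p \<Longrightarrow> z j \<noteq> 0"
  shows "mat_inv (complex_blocks p z) = complex_blocks p (\<lambda>j. inverse (z j))"
  by (rule mat_inv_eqI[of _ "2 * p"])
    (auto simp: complex_blocks_mult complex_blocks_one assms intro!: complex_blocks_cong)

text \<open>For real numbers the blocks are multiples of the identity, so the form is a weighted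
  sum of squares.\<close>

lemma complex_blocks_quadratic_form_nonneg:
  assumes y: "y \<in> carrier_vec (2 * p)" and "\<And>j. j < p \<Longrightarrow> 0 \<le> r j"
  shows "0 \<le> y \<bullet> (complex_blocks p (\<lambda>j. of_real (r j)) *\<^sub>v y)"
proof -
  have "(complex_blocks p (\<lambda>j. of_real (r j)) *\<^sub>v y) $ i = r (i div 2) * y $ i"
    if i: "i < 2 * p" for i
  proof -
    have "(complex_blocks p (\<lambda>j. of_real (r j)) *\<^sub>v y) $ i =
        (\<Sum>k = 0..<2 * p. complex_blocks p (\<lambda>j. of_real (r j)) $$ (i, k) * y $ k)"
      using i y by (auto simp: scalar_prod_def intro!: sum.cong)
    also have "\<dots> = (\<Sum>k = 0..<2 * p. if k = i then r (i div 2) * y $ i else 0)"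
      using i by (intro sum.cong) (auto simp: complex_blocks_def)
    finally show ?thesis using i by simp
  qed
  then have "y \<bullet> (complex_blocks p (\<lambda>j. of_real (r j)) *\<^sub>v y) =
      (\<Sum>i = 0..<2 * p. r (i div 2) * (y $ i)\<^sup>2)"
    by (auto simp: scalar_prod_def power2_eq_square mult_ac simp del: index_mult_mat_vec intro!: sum.cong)
  also have "\<dots> \<ge> 0"
    using assms(2) by (intro sum_nonneg mult_nonneg_nonneg) auto
  finally show ?thesis .
qed

section \<open>Rank of a left-invertible matrix and the matrix of real and imaginary parts\<close>

lemma nth_concat_pairs:
  shows "length (concat (map (\<lambda>j. [f j, g j]) [0..<p])) = 2 * p"
    and "j < p \<Longrightarrow> concat (map (\<lambda>j. [f j, g j]) [0..<p]) ! (2 * j) = f j"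
    and "j < p \<Longrightarrow> concat (map (\<lambda>j. [f j, g j]) [0..<p]) ! Suc (2 * j) = g j"
proof -
  have len: "length (concat (map (\<lambda>j. [f j, g j]) [0..<p])) = 2 * p" for p
    by (induction p) auto
  then show "length (concat (map (\<lambda>j. [f j, g j]) [0..<p])) = 2 * p" .
  have "concat (map (\<lambda>j. [f j, g j]) [0..<p]) ! (2 * j) = f j \<and>
      concat (map (\<lambda>j. [f j, g j]) [0..<p]) ! Suc (2 * j) = g j" if "j < p"
    using that
  proof (induction p)
    case (Suc p)
    then show ?case
      using len[of p] by (cases "j = p") (simp_all add: nth_append)
  qed simp
  then show "j < p \<Longrightarrow> concat (map (\<lambda>j. [f j, g j]) [0..<p]) ! (2 * j) = f j"
    and "j < p \<Longrightarrow> concat (map (\<lambda>j. [f j, g j]) [0..<p]) ! Suc (2 * j) = g j"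
    by auto
qed

lemma re_im_mat_carrier: "re_im_mat n p x \<in> carrier_mat n (2 * p)"
  unfolding re_im_mat_def using mat_of_cols_carrier(1)[of n] nth_concat_pairs(1) by metis

lemma col_re_im_mat:
  assumes "x j \<in> carrier_vec n" "j < p"
  shows "col (re_im_mat n p x) (2 * j) = map_vec Re (x j)"
    and "col (re_im_mat n p x) (Suc (2 * j)) = map_vec Im (x j)"
proof -
  show "col (re_im_mat n p x) (2 * j) = map_vec Re (x j)"
    unfolding re_im_mat_def using assms
    by (subst col_mat_of_cols) (simp_all add: nth_concat_pairs)
  show "col (re_im_mat n p x) (Suc (2 * j)) = map_vec Im (x j)"
    unfolding re_im_mat_def using assms
    by (subst col_mat_of_cols) (simp_all add: nth_concat_pairs)
qed

lemma rank_of_left_inverse: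
  fixes A :: "'a :: field mat"
  assumes A: "A \<in> carrier_mat n p" and B: "B \<in> carrier_mat p n" and BA: "B * A = 1\<^sub>m p"
  shows "vec_space.rank n A = p"
proof (rule vec_space.lin_indpt_full_rank[OF A])
  show distinct: "distinct (cols A)"
    unfolding distinct_conv_nth
  proof (intro allI impI)
    fix i j assume "i < length (cols A)" "j < length (cols A)" "i \<noteq> j"
    with A have ij: "i < p" "j < p" "i \<noteq> j" by auto
    have "B *\<^sub>v col A k = unit_vec p k" if "k < p" for k
      using col_mult2[OF B A that] BA that by simp
    then have "col A i \<noteq> col A j" using ij by (metis unit_vec_eq)
    then show "cols A ! i \<noteq> cols A ! j" using ij A by simp
  qed
  show "\<not> module.lin_dep class_ring (module_vec TYPE('a) n) (set (cols A))"
  proof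
    assume "module.lin_dep class_ring (module_vec TYPE('a) n) (set (cols A))"
    then obtain v where v: "v \<in> carrier_vec p" "v \<noteq> 0\<^sub>v p" "A *\<^sub>v v = 0\<^sub>v n"
      using vec_space.lin_depE[OF A _ distinct] by blast
    have "v = (B * A) *\<^sub>v v" using v BA by simp
    also have "\<dots> = B *\<^sub>v (A *\<^sub>v v)" using A B v by simp
    also have "\<dots> = 0\<^sub>v p" using v B by auto
    finally show False using v by simp
  qed
qed

section \<open>Eigenpairs of a real T-even pencil\<close>

lemma skew_scalar_prod:
  fixes M :: "'a :: comm_ring_1 mat"
  assumes M: "M \<in> carrier_mat n n" "transpose_mat M = - M"
    and u: "u \<in> carrier_vec n" and v: "v \<in> carrier_vec n"
  shows "u \<bullet> (M *\<^sub>v v) = - (v \<bullet> (M *\<^sub>v u))"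
proof -
  have "u \<bullet> (M *\<^sub>v v) = (transpose_mat M *\<^sub>v u) \<bullet> v"
    using transpose_vec_mult_scalar[OF M(1) v u] by simp
  also have "\<dots> = (- (M *\<^sub>v u)) \<bullet> v" using M u by simp
  also have "\<dots> = v \<bullet> (- (M *\<^sub>v u))" using M u v by (intro comm_scalar_prod[of _ n]) auto
  also have "\<dots> = - (v \<bullet> (M *\<^sub>v u))" using M u v by simp
  finally show ?thesis .
qed

lemma eigenpair_real_parts:
  fixes M K :: "real mat"
  assumes M: "M \<in> carrier_mat n n" and K: "K \<in> carrier_mat n n"
    and e: "eigenpair n (cmat M) (cmat K) z x" and i: "i < n"
  defines "u \<equiv> map_vec Re x" and "v \<equiv> map_vec Im x"
  shows "Re z * (M *\<^sub>v u) $ i - Im z * (M *\<^sub>v v) $ i + (K *\<^sub>v u) $ i = 0"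
    and "Re z * (M *\<^sub>v v) $ i + Im z * (M *\<^sub>v u) $ i + (K *\<^sub>v v) $ i = 0"
proof -
  from e have x: "x \<in> carrier_vec n" and "pencil (cmat M) (cmat K) z *\<^sub>v x = 0\<^sub>v n"
    by (auto simp: eigenpair_def)
  then have "(pencil (cmat M) (cmat K) z *\<^sub>v x) $ i = 0" using i by simp
  moreover have "(pencil (cmat M) (cmat K) z *\<^sub>v x) $ i =
      (\<Sum>k = 0..<n. (z * of_real (M $$ (i, k)) + of_real (K $$ (i, k))) * x $ k)"
    using M K x i by (auto simp: pencil_def scalar_prod_def intro!: sum.cong)
  ultimately have *: "(\<Sum>k = 0..<n. (z * of_real (M $$ (i, k)) + of_real (K $$ (i, k))) * x $ k) = 0"
    by simp
  have mv: "(A *\<^sub>v map_vec f x) $ i = (\<Sum>k = 0..<n. A $$ (i, k) * f (x $ k))"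
    if "A \<in> carrier_mat n n" for A and f :: "complex \<Rightarrow> real"
    using that x i by (auto simp: scalar_prod_def intro!: sum.cong)
  have "Re z * (M *\<^sub>v u) $ i - Im z * (M *\<^sub>v v) $ i + (K *\<^sub>v u) $ i = Re (\<Sum>k = 0..<n. (z * of_real (M $$ (i, k)) + of_real (K $$ (i, k))) * x $ k)"
    unfolding u_def v_def mv[OF M] mv[OF K] sum_distrib_left sum_subtractf[symmetric] sum.distrib[symmetric] Re_sum
    by (rule sum.cong) (simp_all add: algebra_simps)
  then show "Re z * (M *\<^sub>v u) $ i - Im z * (M *\<^sub>v v) $ i + (K *\<^sub>v u) $ i = 0" using * by simp
  have "Re z * (M *\<^sub>v v) $ i + Im z * (M *\<^sub>v u) $ i + (K *\<^sub>v v) $ i = Im (\<Sum>k = 0..<n. (z * of_real (M $$ (i, k)) + of_real (K $$ (i, k))) * x $ k)"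
    unfolding u_def v_def mv[OF M] mv[OF K] sum_distrib_left sum_subtractf[symmetric] sum.distrib[symmetric] Im_sum
    by (rule sum.cong) (simp_all add: algebra_simps)
  then show "Re z * (M *\<^sub>v v) $ i + Im z * (M *\<^sub>v u) $ i + (K *\<^sub>v v) $ i = 0" using * by simp
qed

text \<open>Write \<open>x = u + \<i> v\<close>. Pairing the real part of the eigenvalue equation with \<open>u\<close> and using
  that \<open>M\<close> is skew leaves \<open>Im z * (u^T M v) = u^T K u\<close>, so neither factor on the left is zero.
  Pairing with \<open>v\<close> leaves \<open>Re z * (u^T M v) = v^T K u = 0\<close>. Both pairings of
  \<open>u\<close> and \<open>v\<close> through \<open>K\<close> are entries of the normalization \<open>Xc^T K Xc = I\<close>.\<close>

lemma eigenvalue_imaginary: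
  fixes M K :: "real mat"
  assumes M: "M \<in> carrier_mat n n" "transpose_mat M = - M" and K: "K \<in> carrier_mat n n"
    and e: "eigenpair n (cmat M) (cmat K) z x"
    and uu: "map_vec Re x \<bullet> (K *\<^sub>v map_vec Re x) \<noteq> 0"
    and vu: "map_vec Im x \<bullet> (K *\<^sub>v map_vec Re x) = 0"
  shows "Re z = 0" and "Im z \<noteq> 0"
proof -
  define u v where "u = map_vec Re x" and "v = map_vec Im x"
  have uv: "u \<in> carrier_vec n" "v \<in> carrier_vec n"
    using e by (auto simp: u_def v_def eigenpair_def)
  have "K *\<^sub>v u = Im z \<cdot>\<^sub>v (M *\<^sub>v v) - Re z \<cdot>\<^sub>v (M *\<^sub>v u)"
    using eigenpair_real_parts(1)[OF M(1) K e] M(1) K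
    by (intro eq_vecI) (auto simp: u_def v_def algebra_simps simp del: index_mult_mat_vec)
  then have Ku: "w \<bullet> (K *\<^sub>v u) = Im z * (w \<bullet> (M *\<^sub>v v)) - Re z * (w \<bullet> (M *\<^sub>v u))"
    if "w \<in> carrier_vec n" for w
    using that uv M(1) by (simp add: scalar_prod_minus_distrib[of _ n])
  have skew: "u \<bullet> (M *\<^sub>v u) = 0" "v \<bullet> (M *\<^sub>v v) = 0" "v \<bullet> (M *\<^sub>v u) = - (u \<bullet> (M *\<^sub>v v))"
    using skew_scalar_prod[OF M uv(1) uv(1)] skew_scalar_prod[OF M uv(2) uv(2)]
      skew_scalar_prod[OF M uv(2) uv(1)] by linarith+
  from Ku[of u] uu skew uv have 1: "Im z * (u \<bullet> (M *\<^sub>v v)) \<noteq> 0"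
    by (simp add: u_def)
  from Ku[of v] vu skew uv have "Re z * (u \<bullet> (M *\<^sub>v v)) = 0"
    by (simp add: u_def v_def)
  with 1 show "Re z = 0" "Im z \<noteq> 0" by auto
qed

text \<open>The two columns of a block of this matrix equation are the real and the imaginary part of the
  eigenvalue equation for \<open>z = \<i> Im z\<close>.\<close>

lemma re_im_mat_deflating:
  fixes M K :: "real mat"
  assumes M: "M \<in> carrier_mat n n" "transpose_mat M = - M" and K: "K \<in> carrier_mat n n"
    and e: "\<And>j. j < p \<Longrightarrow> eigenpair n (cmat M) (cmat K) (lam j) (x j)"
    and orth: "transpose_mat (re_im_mat n p x) * K * re_im_mat n p x = 1\<^sub>m (2 * p)"
  shows "M * re_im_mat n p x * complex_blocks p (\<lambda>j. \<i> * of_real (Im (lam j))) = - (K * re_im_mat n p x)"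
    and "\<And>j. j < p \<Longrightarrow> Im (lam j) \<noteq> 0"
proof -
  define X where "X = re_im_mat n p x"
  have X: "X \<in> carrier_mat n (2 * p)" unfolding X_def by (rule re_im_mat_carrier)
  have x: "x j \<in> carrier_vec n" if "j < p" for j using e[OF that] by (simp add: eigenpair_def)
  have colX: "col X (2 * j) = map_vec Re (x j)" "col X (Suc (2 * j)) = map_vec Im (x j)"
    if "j < p" for j
    unfolding X_def by (rule col_re_im_mat[of x, OF x[OF that] that])+
  have orth': "col X i \<bullet> (K *\<^sub>v col X k) = (if i = k then 1 else 0)"
    if "i < 2 * p" "k < 2 * p" for i k
  proof -
    have "transpose_mat X * K * X = transpose_mat X * (K * X)" using X K by simp
    then have "1\<^sub>m (2 * p) $$ (i, k) = (transpose_mat X * (K * X)) $$ (i, k)"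
      using orth by (simp only: X_def)
    also have "\<dots> = row (transpose_mat X) i \<bullet> col (K * X) k"
      using that X K by (intro index_mult_mat(1)) auto
    also have "\<dots> = col X i \<bullet> (K *\<^sub>v col X k)"
      using that X K col_mult2[OF K X that(2)] by simp
    finally show ?thesis using that by simp
  qed
  have im: "Re (lam j) = 0 \<and> Im (lam j) \<noteq> 0" if "j < p" for j
  proof -
    have uu: "map_vec Re (x j) \<bullet> (K *\<^sub>v map_vec Re (x j)) \<noteq> 0"
      using orth'[of "2 * j" "2 * j"] colX that by simp
    have vu: "map_vec Im (x j) \<bullet> (K *\<^sub>v map_vec Re (x j)) = 0"
      using orth'[of "Suc (2 * j)" "2 * j"] colX that by simp
    show ?thesis using eigenvalue_imaginary[OF M K e[OF that] uu vu] by simp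
  qed
  then show "\<And>j. j < p \<Longrightarrow> Im (lam j) \<noteq> 0" by simp
  have MX: "M * X \<in> carrier_mat n (2 * p)" using M X by simp
  show "M * re_im_mat n p x * complex_blocks p (\<lambda>j. \<i> * of_real (Im (lam j))) = - (K * re_im_mat n p x)"
    unfolding X_def[symmetric]
  proof (rule eq_matI)
    fix i k assume "i < dim_row (- (K * X))" "k < dim_col (- (K * X))"
    then have i: "i < n" and k: "k < 2 * p" using K X by auto
    have AX: "(A * X) $$ (i, l) = (A *\<^sub>v col X l) $ i" if "A \<in> carrier_mat n n" "l < 2 * p" for A l
      using that X i by simp
    note m = mult_complex_blocks_index[OF MX i, of _ "\<lambda>j. \<i> * of_real (Im (lam j))", unfolded map_mat_of_real_real]
    have neg: "(- (K * X)) $$ (i, k) = - ((K * X) $$ (i, k))" using i k K X by simp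
    show "(M * X * complex_blocks p (\<lambda>j. \<i> * of_real (Im (lam j)))) $$ (i, k) = (- (K * X)) $$ (i, k)"
      using k
    proof (cases rule: less_double_cases)
      case (1 j)
      have "2 * j < 2 * p" "Suc (2 * j) < 2 * p" using 1 by auto
      note AX1 = AX[OF _ this(1)] AX[OF _ this(2)]
      show ?thesis
        unfolding neg unfolding 1(2) m(1)[OF 1(1)] AX1[OF M(1)] AX1[OF K] colX[OF 1(1)]
        using eigenpair_real_parts(1)[OF M(1) K e[OF 1(1)] i] im[OF 1(1)]
        by (simp add: mult.commute del: index_mult_mat_vec)
    next
      case (2 j)
      have "2 * j < 2 * p" "Suc (2 * j) < 2 * p" using 2 by auto
      note AX1 = AX[OF _ this(1)] AX[OF _ this(2)]
      show ?thesis
        unfolding neg unfolding 2(2) m(2)[OF 2(1)] AX1[OF M(1)] AX1[OF K] colX[OF 2(1)]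
        using eigenpair_real_parts(2)[OF M(1) K e[OF 2(1)] i] im[OF 2(1)]
        by (simp add: mult.commute eq_neg_iff_add_eq_0 del: index_mult_mat_vec)
    qed
  qed (use K X M in auto)
qed

section \<open>The Sylvester equation with a skew block matrix\<close>

lemma eq_uminus_of_add_zero:
  fixes A :: "'a :: ab_group_add mat"
  assumes "A \<in> carrier_mat n m" "B \<in> carrier_mat n m" "A + B = 0\<^sub>m n m"
  shows "A = - B"
proof (rule eq_matI)
  fix i j assume ij: "i < dim_row (- B)" "j < dim_col (- B)"
  have "A $$ (i, j) + B $$ (i, j) = (A + B) $$ (i, j)" using ij by simp
  then have "A $$ (i, j) + B $$ (i, j) = 0" using ij assms(2,3) by simp
  then show "A $$ (i, j) = (- B) $$ (i, j)" using ij by (simp add: eq_neg_iff_add_eq_0)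
qed (use assms in auto)

text \<open>The vector \<open>(1, \<mu>)\<close> with \<open>\<mu> = \<i>\<close> or \<open>\<mu> = -\<i>\<close> is an eigenvector of a skew block with
  eigenvalue \<open>\<mu> w\<close>, and an intertwining matrix \<open>W\<close> carries it to an eigenvector of \<open>A\<close>, or to zero.
  Taking \<open>W = 1\<close> gives the spectrum of the block matrix itself.\<close>

lemma complex_blocks_eigenvector:
  fixes A W :: "complex mat" and \<mu> :: complex
  assumes A: "A \<in> carrier_mat m m" and W: "W \<in> carrier_mat m (2 * p)"
    and AW: "A * W = W * cmat (complex_blocks p (\<lambda>j. \<i> * of_real (w j)))"
    and \<mu>: "\<mu> * \<mu> = - 1" and j: "j < p"
  defines "v \<equiv> col W (2 * j) + \<mu> \<cdot>\<^sub>v col W (Suc (2 * j))"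
  shows "A *\<^sub>v v = (\<mu> * of_real (w j)) \<cdot>\<^sub>v v"
proof -
  have k: "2 * j < 2 * p" "Suc (2 * j) < 2 * p" using j by auto
  have c: "(A *\<^sub>v col W k) $ i = (W * cmat (complex_blocks p (\<lambda>j. \<i> * of_real (w j)))) $$ (i, k)"
    if "k < 2 * p" "i < m" for i k
  proof -
    have "A *\<^sub>v col W k = col (A * W) k" by (rule col_mult2[OF A W that(1), symmetric])
    also have "\<dots> $ i = (A * W) $$ (i, k)" using A W that by (intro index_col) auto
    finally show ?thesis by (simp only: AW)
  qed
  have dist: "A *\<^sub>v v = A *\<^sub>v col W (2 * j) + \<mu> \<cdot>\<^sub>v (A *\<^sub>v col W (Suc (2 * j)))"
    unfolding v_def using A W k
    by (subst mult_add_distrib_mat_vec[of _ m m]) (auto simp: mult_mat_vec[of _ m m])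
  show ?thesis
  proof (rule eq_vecI)
    fix i assume "i < dim_vec ((\<mu> * of_real (w j)) \<cdot>\<^sub>v v)"
    then have i: "i < m" using W by (simp add: v_def)
    have "(A *\<^sub>v v) $ i = (A *\<^sub>v col W (2 * j)) $ i + \<mu> * (A *\<^sub>v col W (Suc (2 * j))) $ i"
      unfolding dist using A i by simp
    also have "\<dots> = - (W $$ (i, Suc (2 * j)) * of_real (w j)) + \<mu> * (W $$ (i, 2 * j) * of_real (w j))"
      unfolding c[OF k(1) i] c[OF k(2) i] mult_complex_blocks_index[OF W i j] by simp
    also have "\<dots> = (\<mu> * \<mu>) * (W $$ (i, Suc (2 * j)) * of_real (w j)) + \<mu> * (W $$ (i, 2 * j) * of_real (w j))"
      unfolding \<mu> by simp
    also have "\<dots> = ((\<mu> * of_real (w j)) \<cdot>\<^sub>v v) $ i"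
      using i W k by (simp add: v_def algebra_simps)
    finally show "(A *\<^sub>v v) $ i = ((\<mu> * of_real (w j)) \<cdot>\<^sub>v v) $ i" .
  qed (use A W in \<open>auto simp: v_def\<close>)
qed

lemma complex_blocks_spectrum:
  assumes \<mu>: "\<mu> * \<mu> = - 1" and j: "j < p"
  shows "\<mu> * of_real (w j) \<in> spectrum (cmat (complex_blocks p (\<lambda>j. \<i> * of_real (w j))))"
proof -
  let ?\<Lambda> = "cmat (complex_blocks p (\<lambda>j. \<i> * of_real (w j)))"
  let ?v = "col (1\<^sub>m (2 * p)) (2 * j) + \<mu> \<cdot>\<^sub>v col (1\<^sub>m (2 * p)) (Suc (2 * j))"
  have "?\<Lambda> *\<^sub>v ?v = (\<mu> * of_real (w j)) \<cdot>\<^sub>v ?v"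
    by (rule complex_blocks_eigenvector[OF _ _ _ \<mu> j, of _ "2 * p"]) auto
  moreover have "?v $ (2 * j) = 1" using j by simp
  then have "?v $ (2 * j) \<noteq> 0\<^sub>v (2 * p) $ (2 * j)" using j by simp
  then have "?v \<noteq> 0\<^sub>v (2 * p)" by metis
  moreover have "?v \<in> carrier_vec (2 * p)" by (rule carrier_vecI) simp
  ultimately have "eigenvector ?\<Lambda> ?v (\<mu> * of_real (w j))"
    unfolding eigenvector_def index_map_mat complex_blocks_dim by blast
  then show ?thesis
    unfolding spectrum_def eigenvalue_def by blast
qed

text \<open>Uniqueness in the Sylvester equation. The block matrix is diagonalized by the vectors
  \<open>(1, \<i>)\<close> and \<open>(1, -\<i>)\<close> of each block; \<open>W\<close> has to kill them all, since their eigenvalues are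
  not eigenvalues of \<open>A\<close>.\<close>

lemma complex_blocks_sylvester:
  fixes A W :: "complex mat"
  assumes A: "A \<in> carrier_mat m m" and W: "W \<in> carrier_mat m (2 * p)"
    and AW: "A * W = W * cmat (complex_blocks p (\<lambda>j. \<i> * of_real (w j)))"
    and disj: "spectrum (cmat (complex_blocks p (\<lambda>j. \<i> * of_real (w j)))) \<inter> spectrum A = {}"
  shows "W = 0\<^sub>m m (2 * p)"
proof -
  have zero: "col W (2 * j) + \<mu> \<cdot>\<^sub>v col W (Suc (2 * j)) = 0\<^sub>v m" if "\<mu> * \<mu> = - 1" "j < p" for \<mu> j
  proof (rule ccontr)
    let ?v = "col W (2 * j) + \<mu> \<cdot>\<^sub>v col W (Suc (2 * j))"
    assume "?v \<noteq> 0\<^sub>v m"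
    with complex_blocks_eigenvector[OF A W AW that]
    have "eigenvector A ?v (\<mu> * of_real (w j))"
      using A W by (simp add: eigenvector_def carrier_vecI)
    then have "\<mu> * of_real (w j) \<in> spectrum A"
      unfolding spectrum_def eigenvalue_def by blast
    with complex_blocks_spectrum[OF that] disj show False by blast
  qed
  have *: "W $$ (i, 2 * j) = 0 \<and> W $$ (i, Suc (2 * j)) = 0" if ij: "i < m" "j < p" for i j
  proof -
    have k: "2 * j < 2 * p" "Suc (2 * j) < 2 * p" using ij by auto
    have "W $$ (i, 2 * j) + \<mu> * W $$ (i, Suc (2 * j)) = 0" if "\<mu> * \<mu> = - 1" for \<mu>
    proof -
      have "(col W (2 * j) + \<mu> \<cdot>\<^sub>v col W (Suc (2 * j))) $ i = 0"
        using zero[OF that ij(2)] ij by simp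
      then show ?thesis using W ij k by simp
    qed
    from this[of \<i>] this[of "- \<i>"] show ?thesis by (auto simp: complex_eq_iff)
  qed
  show ?thesis
  proof (rule eq_matI; simp)
    fix i k assume "i < m" "k < 2 * p"
    from \<open>k < 2 * p\<close> show "W $$ (i, k) = 0"
      by (cases rule: less_double_cases) (use * \<open>i < m\<close> in auto)
  qed (use W in auto)
qed

text \<open>Transposing \<open>M X \<Lambda> = - K X\<close> gives \<open>\<Lambda> X^T M = - X^T K\<close>, because \<open>\<Lambda>\<close> and \<open>M\<close> are both skew.
  Hence \<open>Y = X^T M Xf\<close> satisfies \<open>Y \<Lambda>f = - X^T K Xf = \<Lambda> Y\<close>. After transposition this is the Sylvester
  equation for \<open>- \<Lambda>f^T\<close>, so \<open>Y = 0\<close> and then also \<open>X^T K Xf = - \<Lambda> Y = 0\<close>.\<close>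

lemma K_orthogonal_of_disjoint_spectra:
  fixes M K X :: "real mat" and w :: "nat \<Rightarrow> real" and n p q :: nat and Xf \<Lambda>f :: "complex mat"
  defines "\<Lambda> \<equiv> complex_blocks p (\<lambda>j. \<i> * of_real (w j))"
  assumes M: "M \<in> carrier_mat n n" "transpose_mat M = - M"
    and K: "K \<in> carrier_mat n n" "transpose_mat K = K"
    and X: "X \<in> carrier_mat n (2 * p)" and MX: "M * X * \<Lambda> = - (K * X)"
    and Xf: "Xf \<in> carrier_mat n q" and Lf: "\<Lambda>f \<in> carrier_mat q q"
    and f: "cmat M * Xf * \<Lambda>f + cmat K * Xf = 0\<^sub>m n q"
    and disj: "spectrum (cmat (\<Lambda>)) \<inter> spectrum (- transpose_mat \<Lambda>f) = {}"
  shows "cmat (transpose_mat X * K) * Xf = 0\<^sub>m (2 * p) q"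
proof -
  let ?L = "cmat (\<Lambda>)"
  have L: "\<Lambda> \<in> carrier_mat (2 * p) (2 * p)" by (simp add: \<Lambda>_def)
  have skew: "transpose_mat (\<Lambda>) = - \<Lambda>"
    by (simp add: \<Lambda>_def complex_blocks_transpose complex_blocks_uminus)
  have Xt: "transpose_mat X \<in> carrier_mat (2 * p) n" using X by simp
  have XM: "transpose_mat X * M \<in> carrier_mat (2 * p) n" using Xt M by simp
  have XK: "\<Lambda> * (transpose_mat X * M) = - (transpose_mat X * K)"
  proof -
    have "transpose_mat (M * X * \<Lambda>) = transpose_mat (\<Lambda>) * (transpose_mat X * transpose_mat M)"
      using M X L by (simp add: transpose_mult[of _ n "2 * p" _ "2 * p"] transpose_mult[of _ n n _ "2 * p"])
    also have "\<dots> = \<Lambda> * (transpose_mat X * M)"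
      unfolding skew M using XM Xt M L by simp
    finally have "\<Lambda> * (transpose_mat X * M) = transpose_mat (- (K * X))" by (simp only: MX)
    also have "\<dots> = - transpose_mat (K * X)" by (simp add: transpose_uminus)
    also have "\<dots> = - (transpose_mat X * K)" using K X by (simp add: transpose_mult[of _ n n _ "2 * p"])
    finally show ?thesis .
  qed
  define Y where "Y = cmat (transpose_mat X * M) * Xf"
  have cXM: "cmat (transpose_mat X * M) \<in> carrier_mat (2 * p) n" using XM by simp
  have Y: "Y \<in> carrier_mat (2 * p) q" using cXM Xf by (simp add: Y_def)
  have cL: "?L \<in> carrier_mat (2 * p) (2 * p)" using L by simp
  have LY: "?L * Y = - (cmat (transpose_mat X * K) * Xf)"
  proof -
    have "?L * Y = (?L * cmat (transpose_mat X * M)) * Xf"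
      unfolding Y_def by (rule assoc_mult_mat[OF cL cXM Xf, symmetric])
    also have "?L * cmat (transpose_mat X * M) = cmat (- (transpose_mat X * K))"
      unfolding XK[symmetric] by (rule of_real_hom.mat_hom_mult[OF L XM, symmetric])
    also have "\<dots> = - cmat (transpose_mat X * K)" by (rule eq_matI) auto
    also have "\<dots> * Xf = - (cmat (transpose_mat X * K) * Xf)" using Xt K Xf by simp
    finally show ?thesis .
  qed
  have YL: "Y * \<Lambda>f = ?L * Y"
  proof -
    have cM: "cmat M \<in> carrier_mat n n" and cK: "cmat K \<in> carrier_mat n n"
      and cXt: "cmat (transpose_mat X) \<in> carrier_mat (2 * p) n" using M K Xt by auto
    have cMXf: "cmat M * Xf \<in> carrier_mat n q" and cKXf: "cmat K * Xf \<in> carrier_mat n q"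
      using cM cK Xf by auto
    have "Y * \<Lambda>f = cmat (transpose_mat X) * (cmat M * Xf * \<Lambda>f)"
      unfolding Y_def of_real_hom.mat_hom_mult[OF Xt M(1)] by (simp only: assoc_mult_mat[OF cXt cM Xf] assoc_mult_mat[OF cXt cMXf Lf])
    also have "cmat M * Xf * \<Lambda>f = - (cmat K * Xf)"
      using f cM cK Xf Lf by (intro eq_uminus_of_add_zero) auto
    also have "cmat (transpose_mat X) * - (cmat K * Xf) = - (cmat (transpose_mat X * K) * Xf)"
      unfolding of_real_hom.mat_hom_mult[OF Xt K(1)] assoc_mult_mat[OF cXt cK Xf]
      by (rule uminus_mult_right_mat) (use cXt cK in simp)
    finally show ?thesis by (simp only: LY)
  qed
  have "- transpose_mat \<Lambda>f * transpose_mat Y = transpose_mat Y * ?L"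
  proof -
    have "- transpose_mat \<Lambda>f * transpose_mat Y = - transpose_mat (Y * \<Lambda>f)"
      using Y Lf by (simp add: transpose_mult[of _ "2 * p" q _ q])
    also have "\<dots> = - (transpose_mat Y * transpose_mat ?L)"
      unfolding YL using Y cL by (simp add: transpose_mult[of _ "2 * p" "2 * p" _ q])
    also have "transpose_mat ?L = cmat (transpose_mat (\<Lambda>))" by (rule eq_matI) auto
    also have "\<dots> = - ?L" unfolding skew by (rule eq_matI) auto
    also have "- (transpose_mat Y * - ?L) = transpose_mat Y * ?L" using Y cL by simp
    finally show ?thesis .
  qed
  then have "transpose_mat Y = 0\<^sub>m q (2 * p)"
    using Y Lf disj unfolding \<Lambda>_def by (intro complex_blocks_sylvester) auto
  then have "Y = 0\<^sub>m (2 * p) q" by (metis transpose_transpose zero_transpose_mat)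
  then have "- (cmat (transpose_mat X * K) * Xf) = 0\<^sub>m (2 * p) q" using LY cL by simp
  then have "cmat (transpose_mat X * K) * Xf = - 0\<^sub>m (2 * p) q" by (metis uminus_uminus_mat)
  also have "- 0\<^sub>m (2 * p) q = (0\<^sub>m (2 * p) q :: complex mat)" by (rule eq_matI) auto
  finally show ?thesis .
qed

section \<open>Modifications of the form \<open>K X H X\<^sup>T K\<close>\<close>

lemma cmat_add:
  "A \<in> carrier_mat n m \<Longrightarrow> B \<in> carrier_mat n m \<Longrightarrow> cmat (A + B) = cmat A + cmat B"
  by (rule eq_matI) auto

text \<open>With dimension equations as premises instead of carrier sets there is no intermediate dimension
  to guess, and the rule rewrites long products reliably.\<close>

lemma mult_assoc_dim:
  "dim_col A = dim_row B \<Longrightarrow> dim_col B = dim_row C \<Longrightarrow> A * B * C = A * (B * C)"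
  by (rule assoc_mult_mat[of _ "dim_row A" "dim_col A" _ "dim_col B" _ "dim_col C"]) auto

lemma transpose_mult_dim:
  fixes A B :: "'a :: comm_semiring_0 mat"
  shows "dim_col A = dim_row B \<Longrightarrow> transpose_mat (A * B) = transpose_mat B * transpose_mat A"
  by (rule transpose_mult[of _ "dim_row A" "dim_col A" _ "dim_col B"]) auto

lemma modification_mult:
  fixes K X H :: "'a :: comm_ring_1 mat"
  assumes K: "K \<in> carrier_mat n n" and X: "X \<in> carrier_mat n m" and H: "H \<in> carrier_mat m m"
    and orth: "transpose_mat X * K * X = 1\<^sub>m m"
  shows "K * X * H * transpose_mat X * K * X = K * X * H"
proof -
  have "K * X * H * transpose_mat X * K * X = K * X * H * (transpose_mat X * K * X)"
    using carrier_matD[OF K] carrier_matD[OF X] carrier_matD[OF H]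
    by (simp add: mult_assoc_dim del: assoc_mult_mat)
  then show ?thesis unfolding orth using K X H by simp
qed

lemma modification_annihilates:
  fixes K X H :: "real mat" and Y :: "complex mat"
  assumes K: "K \<in> carrier_mat n n" and X: "X \<in> carrier_mat n m" and H: "H \<in> carrier_mat m m"
    and Y: "Y \<in> carrier_mat n q" and zero: "cmat (transpose_mat X * K) * Y = 0\<^sub>m m q"
  shows "cmat (K * X * H * transpose_mat X * K) * Y = 0\<^sub>m n q"
proof -
  have Xt: "transpose_mat X \<in> carrier_mat m n" using X by simp
  have P: "K * X * H \<in> carrier_mat n m" "transpose_mat X * K \<in> carrier_mat m n"
    using K X H Xt by auto
  have "K * X * H * transpose_mat X * K = (K * X * H) * (transpose_mat X * K)"
    using carrier_matD[OF K] carrier_matD[OF X] carrier_matD[OF H]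
    by (simp add: mult_assoc_dim del: assoc_mult_mat)
  then have "cmat (K * X * H * transpose_mat X * K) * Y
      = (cmat (K * X * H) * cmat (transpose_mat X * K)) * Y"
    by (simp only: of_real_hom.mat_hom_mult[OF P])
  also have "\<dots> = cmat (K * X * H) * (cmat (transpose_mat X * K) * Y)"
    by (rule assoc_mult_mat[of _ n m _ n _ q]) (use P Y in auto)
  also have "\<dots> = 0\<^sub>m n q" unfolding zero using P by (simp add: right_mult_zero_mat[of _ n m])
  finally show ?thesis .
qed

lemma modification_transpose:
  fixes K X H :: "'a :: comm_ring_1 mat"
  assumes K: "K \<in> carrier_mat n n" "transpose_mat K = K" and X: "X \<in> carrier_mat n m"
    and H: "H \<in> carrier_mat m m"
  shows "transpose_mat (K * X * H * transpose_mat X * K) = K * X * transpose_mat H * transpose_mat X * K"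
proof -
  have "transpose_mat (K * X * H * transpose_mat X * K)
      = transpose_mat K * (X * (transpose_mat H * (transpose_mat X * transpose_mat K)))"
    using carrier_matD[OF K(1)] carrier_matD[OF X] carrier_matD[OF H]
    by (simp add: transpose_mult_dim del: assoc_mult_mat)
  then show ?thesis
    unfolding K(2) using carrier_matD[OF K(1)] carrier_matD[OF X] carrier_matD[OF H]
    by (simp add: mult_assoc_dim del: assoc_mult_mat)
qed

lemma modification_quadratic_form:
  fixes K X H :: "'a :: comm_ring_1 mat"
  assumes K: "K \<in> carrier_mat n n" "transpose_mat K = K" and X: "X \<in> carrier_mat n m"
    and H: "H \<in> carrier_mat m m" and v: "v \<in> carrier_vec n"
  defines "y \<equiv> (transpose_mat X * K) *\<^sub>v v"
  shows "v \<bullet> ((K * X * H * transpose_mat X * K) *\<^sub>v v) = y \<bullet> (H *\<^sub>v y)"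
proof -
  have Xt: "transpose_mat X \<in> carrier_mat m n" using X by simp
  have P: "K * X \<in> carrier_mat n m" and Pt: "transpose_mat X * K \<in> carrier_mat m n"
    and t: "transpose_mat (K * X) = transpose_mat X * K"
    using K X Xt by (auto simp: transpose_mult[of _ n n _ m])
  have y: "y \<in> carrier_vec m" unfolding y_def by (rule mult_mat_vec_carrier[OF Pt v])
  have "K * X * H * transpose_mat X * K = (K * X) * (H * (transpose_mat X * K))"
    using carrier_matD[OF K(1)] carrier_matD[OF X] carrier_matD[OF H]
    by (simp add: mult_assoc_dim del: assoc_mult_mat)
  also have "\<dots> *\<^sub>v v = (K * X) *\<^sub>v ((H * (transpose_mat X * K)) *\<^sub>v v)"
    by (rule assoc_mult_mat_vec[of _ n m _ n]) (use P Pt H v in auto)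
  also have "(H * (transpose_mat X * K)) *\<^sub>v v = H *\<^sub>v y"
    unfolding y_def by (rule assoc_mult_mat_vec[OF H Pt v])
  finally have "v \<bullet> ((K * X * H * transpose_mat X * K) *\<^sub>v v) = v \<bullet> ((K * X) *\<^sub>v (H *\<^sub>v y))"
    by simp
  also have "\<dots> = (transpose_mat (K * X) *\<^sub>v v) \<bullet> (H *\<^sub>v y)"
    by (rule transpose_vec_mult_scalar[OF P _ v, symmetric]) (use H y in simp)
  finally show ?thesis by (simp only: t y_def)
qed

section \<open>Updating the eigenvalues\<close>

theorem mainTheorem10:
  fixes n p q :: nat
    and M K Xc \<Lambda>c \<Lambda>a Z1 Z2 Ha Mhat Khat \<Delta>M \<Delta>K :: "real mat"
    and lamc lama :: "nat \<Rightarrow> complex"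
    and xc :: "nat \<Rightarrow> complex vec"
    and Xf \<Lambda>f :: "complex mat"
    and \<alpha> \<beta> :: "nat \<Rightarrow> real"
  assumes "M \<in> carrier_mat n n" and "K \<in> carrier_mat n n"
    and "T_even M K"
    and "pos_def n K"
    and "\<And>i. i < p \<Longrightarrow> eigenpair n (cmat M) (cmat K) (lamc i) (xc i)"
    and "\<And>i. i < p \<Longrightarrow> eigenpair n (cmat M) (cmat K) (cnj (lamc i)) (conjugate (xc i))"
    and "\<And>i. i < p \<Longrightarrow> lamc i \<noteq> 0"
    and "Xc = re_im_mat n p xc"
    and "transpose_mat Xc * K * Xc = 1\<^sub>m (2 * p)"
    and "\<And>i. i < p \<Longrightarrow> Re (lama i) = 0"
    and "\<Lambda>c = skew_blocks p (\<lambda>j. Im (lamc j))"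
    and "\<Lambda>a = skew_blocks p (\<lambda>j. Im (lama j))"
    and "deflating_pair n q (cmat M) (cmat K) (Xf, \<Lambda>f)"
    and "complementary n (cmat Xc, cmat \<Lambda>c) (Xf, \<Lambda>f)"
    and "spectrum (cmat \<Lambda>c) \<inter> spectrum (- transpose_mat \<Lambda>f) = {}"
    and "Z1 = skew_blocks p \<alpha>"
    and "Z2 = scalar_blocks p \<beta>"
    and "Ha = mat_inv (1\<^sub>m (2 * p) - \<Lambda>a ^\<^sub>m 2)"
    and "Mhat = Ha * (mat_inv \<Lambda>c * (\<Lambda>c - \<Lambda>a) * \<Lambda>a + Z1 + Z2 * \<Lambda>a)"
    and "Khat = Ha * (mat_inv \<Lambda>c * (\<Lambda>a - \<Lambda>c) - Z1 * \<Lambda>a - Z2 * \<Lambda>a ^\<^sub>m 2)"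
    and "\<Delta>M = K * Xc * Mhat * transpose_mat Xc * K"
    and "\<Delta>K = K * Xc * Khat * transpose_mat Xc * K"
  shows "deflating_pair n (2 * p) (cmat (M + \<Delta>M)) (cmat (K + \<Delta>K)) (cmat Xc, cmat \<Lambda>a)
    \<and> deflating_pair n q (cmat (M + \<Delta>M)) (cmat (K + \<Delta>K)) (Xf, \<Lambda>f)
    \<and> complementary n (cmat Xc, cmat \<Lambda>a) (Xf, \<Lambda>f)
    \<and> T_even (M + \<Delta>M) (K + \<Delta>K)
    \<and> (let D = mat_inv \<Lambda>c * (\<Lambda>a - \<Lambda>c) - Z1 * \<Lambda>a - Z2 * \<Lambda>a ^\<^sub>m 2
       in diagonal_mat D \<and> (\<forall>i < 2 * p. D $$ (i, i) \<ge> 0) \<longrightarrow> pos_def n (K + \<Delta>K))"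
proof -
  \<comment> \<open>The complex numbers behind \<open>\<Lambda>c\<close>, \<open>\<Lambda>a\<close>, \<open>Z1\<close>, \<open>Z2\<close> and then behind \<open>Ha\<close>, \<open>D\<close>, \<open>Mhat\<close>, \<open>Khat\<close>.\<close>
  define c a al be where "c j = \<i> * complex_of_real (Im (lamc j))"
    and "a j = \<i> * complex_of_real (Im (lama j))"
    and "al j = \<i> * complex_of_real (\<alpha> j)" and "be j = complex_of_real (\<beta> j)" for j
  define h d m k where "h j = inverse (1 - a j * a j)"
    and "d j = inverse (c j) * (a j - c j) - al j * a j - be j * (a j * a j)"
    and "m j = h j * (inverse (c j) * (c j - a j) * a j + al j + be j * a j)"
    and "k j = h j * d j" for j
  note M = \<open>M \<in> carrier_mat n n\<close> and K = \<open>K \<in> carrier_mat n n\<close>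
  have Mt: "transpose_mat M = - M" and Kt: "transpose_mat K = K"
    using \<open>T_even M K\<close> by (auto simp: T_even_def)
  have X: "Xc \<in> carrier_mat n (2 * p)" unfolding \<open>Xc = re_im_mat n p xc\<close> by (rule re_im_mat_carrier)
  note orth = \<open>transpose_mat Xc * K * Xc = 1\<^sub>m (2 * p)\<close>
  have Lc: "\<Lambda>c = complex_blocks p c" and La: "\<Lambda>a = complex_blocks p a"
    and Z1: "Z1 = complex_blocks p al" and Z2: "Z2 = complex_blocks p be"
    unfolding \<open>\<Lambda>c = _\<close> \<open>\<Lambda>a = _\<close> \<open>Z1 = _\<close> \<open>Z2 = _\<close> skew_blocks_eq scalar_blocks_eq
    by (simp_all add: c_def[abs_def] a_def[abs_def] al_def[abs_def] be_def[abs_def])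
  note deflating = re_im_mat_deflating[where lam = lamc and x = xc and p = p, OF M Mt K assms(5),
      folded \<open>Xc = re_im_mat n p xc\<close> c_def, OF _ orth]
  have MXc: "M * Xc * complex_blocks p c = - (K * Xc)" using deflating(1) by simp
  have c0: "c j \<noteq> 0" if "j < p" for j using deflating(2) that by (simp add: c_def)
  have den: "1 - a j * a j = of_real (1 + (Im (lama j))\<^sup>2)" for j
    by (simp add: a_def power2_eq_square complex_eq_iff)
  have den0: "1 - a j * a j \<noteq> 0" for j
    unfolding den of_real_eq_0_iff using zero_le_power2[of "Im (lama j)"] by linarith
  have h: "h j = of_real (inverse (1 + (Im (lama j))\<^sup>2))" for j
    unfolding h_def den by simp

  have inv_c: "mat_inv (complex_blocks p c) = complex_blocks p (\<lambda>j. inverse (c j))"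
    by (rule complex_blocks_inverse[OF c0])
  have Ha: "Ha = complex_blocks p h"
    unfolding \<open>Ha = _\<close> La complex_blocks_square complex_blocks_one complex_blocks_minus h_def[abs_def]
    by (rule complex_blocks_inverse[OF den0])
  have D: "mat_inv \<Lambda>c * (\<Lambda>a - \<Lambda>c) - Z1 * \<Lambda>a - Z2 * \<Lambda>a ^\<^sub>m 2 = complex_blocks p d"
    unfolding inv_c La Lc Z1 Z2 complex_blocks_square complex_blocks_minus complex_blocks_mult d_def[abs_def] ..
  have Khat: "Khat = complex_blocks p k"
    unfolding \<open>Khat = _\<close> D Ha complex_blocks_mult k_def[abs_def] ..
  have Mhat: "Mhat = complex_blocks p m"
    unfolding \<open>Mhat = _\<close> inv_c La Lc Z1 Z2 Ha complex_blocks_minus complex_blocks_mult complex_blocks_add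
      m_def[abs_def] ..
  have MhatC: "Mhat \<in> carrier_mat (2 * p) (2 * p)" and KhatC: "Khat \<in> carrier_mat (2 * p) (2 * p)"
    by (simp_all add: Mhat Khat)
  have dM: "\<Delta>M \<in> carrier_mat n n" and dK: "\<Delta>K \<in> carrier_mat n n"
    using K X MhatC KhatC by (auto simp: \<open>\<Delta>M = _\<close> \<open>\<Delta>K = _\<close>)

  have cnj: "cnj (c j) = - c j" "cnj (a j) = - a j" "cnj (al j) = - al j" "cnj (be j) = be j" for j
    by (simp_all add: c_def a_def al_def be_def)
  have cnj_h: "cnj (h j) = h j" for j by (simp add: h)
  have cnj_d: "cnj (d j) = d j" for j by (simp add: d_def cnj algebra_simps)
  have cnj_k: "cnj (k j) = k j" for j by (simp add: k_def cnj_h cnj_d)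
  have cnj_m: "cnj (m j) = - m j" for j by (simp add: m_def cnj cnj_h algebra_simps)
  have Mhat_skew: "transpose_mat Mhat = - Mhat"
    by (simp add: Mhat complex_blocks_transpose complex_blocks_uminus cnj_m)
  have Khat_sym: "transpose_mat Khat = Khat"
    by (simp add: Khat complex_blocks_transpose cnj_k)
  have dKt: "transpose_mat \<Delta>K = \<Delta>K"
    unfolding \<open>\<Delta>K = _\<close> modification_transpose[OF K Kt X KhatC] Khat_sym ..
  have dMt: "transpose_mat \<Delta>M = - \<Delta>M"
    unfolding \<open>\<Delta>M = _\<close> modification_transpose[OF K Kt X MhatC] Mhat_skew
    using K X MhatC by (simp del: assoc_mult_mat)
  have even: "T_even (M + \<Delta>M) (K + \<Delta>K)"
    unfolding T_even_def using M K dM dK Mt Kt dMt dKt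
    by (auto simp: transpose_add[of _ n n] intro!: eq_matI)

  have P: "K * Xc \<in> carrier_mat n (2 * p)" using K X by simp
  have MX: "M * Xc = K * Xc * complex_blocks p (\<lambda>j. - inverse (c j))"
  proof -
    have MXC: "M * Xc \<in> carrier_mat n (2 * p)" using M X by simp
    have "complex_blocks p c * complex_blocks p (\<lambda>j. inverse (c j)) = 1\<^sub>m (2 * p)"
      unfolding complex_blocks_mult complex_blocks_one by (rule complex_blocks_cong) (simp add: c0)
    then have "M * Xc = M * Xc * (complex_blocks p c * complex_blocks p (\<lambda>j. inverse (c j)))"
      using right_mult_one_mat[OF MXC] by simp
    also have "\<dots> = (M * Xc * complex_blocks p c) * complex_blocks p (\<lambda>j. inverse (c j))"
      by (rule assoc_mult_mat[OF MXC complex_blocks_carrier complex_blocks_carrier, symmetric])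
    also have "\<dots> = - (K * Xc) * complex_blocks p (\<lambda>j. inverse (c j))" unfolding MXc ..
    also have "\<dots> = K * Xc * (- complex_blocks p (\<lambda>j. inverse (c j)))"
      using carrier_matD[OF X] by (simp del: assoc_mult_mat)
    finally show ?thesis by (simp only: complex_blocks_uminus)
  qed
  have split: "K * Xc * complex_blocks p (\<lambda>j. f j + g j)
      = K * Xc * complex_blocks p f + K * Xc * complex_blocks p g" for f g
    unfolding complex_blocks_add[symmetric]
    by (rule mult_add_distrib_mat[OF P complex_blocks_carrier complex_blocks_carrier])
  have MdX: "(M + \<Delta>M) * Xc = K * Xc * complex_blocks p (\<lambda>j. - inverse (c j) + m j)"
  proof -
    have "(M + \<Delta>M) * Xc = M * Xc + \<Delta>M * Xc" by (rule add_mult_distrib_mat[OF M dM X])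
    also have "\<Delta>M * Xc = K * Xc * Mhat"
      unfolding \<open>\<Delta>M = _\<close> by (rule modification_mult[OF K X MhatC orth])
    finally show ?thesis
      unfolding MX Mhat by (simp only: split)
  qed
  have KdX: "(K + \<Delta>K) * Xc = K * Xc * complex_blocks p (\<lambda>j. 1 + k j)"
  proof -
    have "(K + \<Delta>K) * Xc = K * Xc + \<Delta>K * Xc" by (rule add_mult_distrib_mat[OF K dK X])
    also have "\<Delta>K * Xc = K * Xc * Khat"
      unfolding \<open>\<Delta>K = _\<close> by (rule modification_mult[OF K X KhatC orth])
    also have "K * Xc + K * Xc * Khat = K * Xc * 1\<^sub>m (2 * p) + K * Xc * Khat"
      by (simp only: right_mult_one_mat[OF P])
    finally show ?thesis
      unfolding Khat complex_blocks_one by (simp only: split)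
  qed
  \<comment> \<open>The scalar identity on which the choice of \<open>Mhat\<close> and \<open>Khat\<close> rests.\<close>
  have key: "(- inverse (c j) + m j) * a j + (1 + k j) = 0" if "j < p" for j
  proof -
    have "m j * a j + k j = h j * (inverse (c j) * (a j - c j) * (1 - a j * a j))"
      unfolding m_def k_def d_def by (simp add: algebra_simps)
    also have "\<dots> = inverse (c j) * (a j - c j) * (h j * (1 - a j * a j))"
      by (rule mult.left_commute)
    also have "h j * (1 - a j * a j) = 1"
      unfolding h_def by (rule left_inverse[OF den0])
    also have "inverse (c j) * (a j - c j) * 1 = inverse (c j) * (a j - c j)" by simp
    also have "\<dots> = inverse (c j) * a j - 1"
      using c0[OF that] by (simp add: field_simps)
    finally show ?thesis by (simp add: algebra_simps)
  qed
  have real_eq: "(M + \<Delta>M) * Xc * \<Lambda>a + (K + \<Delta>K) * Xc = 0\<^sub>m n (2 * p)"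
  proof -
    have "(M + \<Delta>M) * Xc * \<Lambda>a = K * Xc * complex_blocks p (\<lambda>j. (- inverse (c j) + m j) * a j)"
      unfolding MdX La complex_blocks_mult[symmetric]
      by (rule assoc_mult_mat[OF P complex_blocks_carrier complex_blocks_carrier])
    then have "(M + \<Delta>M) * Xc * \<Lambda>a + (K + \<Delta>K) * Xc
        = K * Xc * complex_blocks p (\<lambda>j. (- inverse (c j) + m j) * a j + (1 + k j))"
      unfolding KdX
      by (simp only: split[of "\<lambda>j. (- inverse (c j) + m j) * a j" "\<lambda>j. 1 + k j"])
    also have "complex_blocks p (\<lambda>j. (- inverse (c j) + m j) * a j + (1 + k j)) = 0\<^sub>m (2 * p) (2 * p)"
      unfolding complex_blocks_zero[symmetric] by (rule complex_blocks_cong) (rule key)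
    also have "K * Xc * 0\<^sub>m (2 * p) (2 * p) = 0\<^sub>m n (2 * p)" by (rule right_mult_zero_mat[OF P])
    finally show ?thesis .
  qed

  from \<open>deflating_pair n q (cmat M) (cmat K) (Xf, \<Lambda>f)\<close>
  have Xf: "Xf \<in> carrier_mat n q" and Lf: "\<Lambda>f \<in> carrier_mat q q" and rank_f: "vec_space.rank n Xf = q"
    and qn: "q \<le> n" and f: "cmat M * Xf * \<Lambda>f + cmat K * Xf = 0\<^sub>m n q"
    by (auto simp: deflating_pair_def)
  have compl: "complementary n (cmat Xc, cmat \<Lambda>a) (Xf, \<Lambda>f)"
    using \<open>complementary n (cmat Xc, cmat \<Lambda>c) (Xf, \<Lambda>f)\<close> by (simp add: complementary_def)
  \<comment> \<open>An invertible matrix is square, so complementarity says \<open>2 * p + q = n\<close>.\<close>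
  have "2 * p \<le> n"
    using compl X Xf unfolding complementary_def invertible_mat_def by simp
  moreover have "vec_space.rank n (cmat Xc) = 2 * p"
  proof (rule rank_of_left_inverse)
    show "cmat Xc \<in> carrier_mat n (2 * p)" using X by simp
    have XtK: "transpose_mat Xc * K \<in> carrier_mat (2 * p) n" using X K by simp
    then show "cmat (transpose_mat Xc * K) \<in> carrier_mat (2 * p) n" by simp
    show "cmat (transpose_mat Xc * K) * cmat Xc = 1\<^sub>m (2 * p)"
      unfolding of_real_hom.mat_hom_mult[OF XtK X, symmetric] orth by (rule of_real_hom.mat_hom_one)
  qed
  moreover have "cmat (M + \<Delta>M) * cmat Xc * cmat \<Lambda>a + cmat (K + \<Delta>K) * cmat Xc = 0\<^sub>m n (2 * p)"
  proof -
    have A: "M + \<Delta>M \<in> carrier_mat n n" "K + \<Delta>K \<in> carrier_mat n n" using dM dK by auto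
    have AX: "(M + \<Delta>M) * Xc \<in> carrier_mat n (2 * p)" and LaC: "\<Lambda>a \<in> carrier_mat (2 * p) (2 * p)"
      using A X by (auto simp: La)
    have "cmat (M + \<Delta>M) * cmat Xc * cmat \<Lambda>a + cmat (K + \<Delta>K) * cmat Xc
        = cmat ((M + \<Delta>M) * Xc * \<Lambda>a) + cmat ((K + \<Delta>K) * Xc)"
      by (simp only: of_real_hom.mat_hom_mult[OF A(1) X] of_real_hom.mat_hom_mult[OF AX LaC]
          of_real_hom.mat_hom_mult[OF A(2) X])
    also have "\<dots> = cmat ((M + \<Delta>M) * Xc * \<Lambda>a + (K + \<Delta>K) * Xc)"
      by (rule cmat_add[of _ n "2 * p", symmetric]) (use A X LaC in auto)
    also have "\<dots> = 0\<^sub>m n (2 * p)" unfolding real_eq by (rule eq_matI) auto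
    finally show ?thesis .
  qed
  ultimately have defl_c: "deflating_pair n (2 * p) (cmat (M + \<Delta>M)) (cmat (K + \<Delta>K)) (cmat Xc, cmat \<Lambda>a)"
    using X by (simp add: deflating_pair_def La)

  have "spectrum (cmat (complex_blocks p c)) \<inter> spectrum (- transpose_mat \<Lambda>f) = {}"
    using \<open>spectrum (cmat \<Lambda>c) \<inter> spectrum (- transpose_mat \<Lambda>f) = {}\<close> by (simp only: Lc)
  then have KXf: "cmat (transpose_mat Xc * K) * Xf = 0\<^sub>m (2 * p) q"
    using K_orthogonal_of_disjoint_spectra[OF M Mt K Kt X _ Xf Lf f, of "\<lambda>j. Im (lamc j)", folded c_def] MXc
    by simp
  have defl_f: "deflating_pair n q (cmat (M + \<Delta>M)) (cmat (K + \<Delta>K)) (Xf, \<Lambda>f)"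
  proof -
    have add: "cmat (A + \<Delta>) * Xf = cmat A * Xf"
      if "A \<in> carrier_mat n n" "\<Delta> \<in> carrier_mat n n" "cmat \<Delta> * Xf = 0\<^sub>m n q" for A \<Delta> :: "real mat"
    proof -
      have "cmat (A + \<Delta>) = cmat A + cmat \<Delta>" by (rule cmat_add[OF that(1,2)])
      then have "cmat (A + \<Delta>) * Xf = cmat A * Xf + cmat \<Delta> * Xf"
        using add_mult_distrib_mat[of "cmat A" n n "cmat \<Delta>" Xf q] that Xf by simp
      then show ?thesis using that Xf by simp
    qed
    have "cmat \<Delta>M * Xf = 0\<^sub>m n q" "cmat \<Delta>K * Xf = 0\<^sub>m n q"
      unfolding \<open>\<Delta>M = _\<close> \<open>\<Delta>K = _\<close>
      using modification_annihilates[OF K X MhatC Xf KXf] modification_annihilates[OF K X KhatC Xf KXf] by auto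
    then show ?thesis
      using Xf Lf rank_f qn f by (simp add: deflating_pair_def add[OF M dM] add[OF K dK])
  qed

  have pd: "pos_def n (K + \<Delta>K)" if nonneg: "\<forall>i < 2 * p. complex_blocks p d $$ (i, i) \<ge> 0"
  proof -
    define r where "r j = inverse (1 + (Im (lama j))\<^sup>2) * Re (d j)" for j
    have "k j = of_real (r j)" for j
    proof -
      have "d j = of_real (Re (d j))" using cnj_d[of j] by (simp add: complex_eq_iff)
      then show ?thesis unfolding k_def h r_def by simp
    qed
    then have Khat_r: "Khat = complex_blocks p (\<lambda>j. of_real (r j))"
      unfolding Khat by (rule complex_blocks_cong)
    have r: "0 \<le> r j" if "j < p" for j
    proof -
      have "0 \<le> Re (d j)"
        using nonneg[rule_format, of "2 * j"] complex_blocks_index(1)[OF that that, of d] that by simp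
      then show ?thesis by (simp add: r_def)
    qed
    have "v \<bullet> ((K + \<Delta>K) *\<^sub>v v) > 0" if v: "v \<in> carrier_vec n" "v \<noteq> 0\<^sub>v n" for v
    proof -
      have "v \<bullet> ((K + \<Delta>K) *\<^sub>v v) = v \<bullet> (K *\<^sub>v v + \<Delta>K *\<^sub>v v)"
        by (simp only: add_mult_distrib_mat_vec[OF K dK v(1)])
      also have "\<dots> = v \<bullet> (K *\<^sub>v v) + v \<bullet> (\<Delta>K *\<^sub>v v)"
        using v K dK by (intro scalar_prod_add_distrib[of _ n]) auto
      finally have "v \<bullet> ((K + \<Delta>K) *\<^sub>v v) = v \<bullet> (K *\<^sub>v v) + v \<bullet> (\<Delta>K *\<^sub>v v)" .
      moreover have "0 < v \<bullet> (K *\<^sub>v v)" using \<open>pos_def n K\<close> v by (auto simp: pos_def_def)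
      moreover have "0 \<le> v \<bullet> (\<Delta>K *\<^sub>v v)"
        unfolding \<open>\<Delta>K = _\<close> modification_quadratic_form[OF K Kt X KhatC v(1)] unfolding Khat_r
        by (rule complex_blocks_quadratic_form_nonneg[OF _ r]) (use X K v in auto)
      ultimately show ?thesis by linarith
    qed
    then show ?thesis
      using K dK even by (auto simp: pos_def_def T_even_def)
  qed
  show ?thesis
    unfolding Let_def D using defl_c defl_f compl even pd by blast
qed

end
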